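(* Let $F$ be R. Thompson's group, generated by $\{x_0,x_1\}$. The density of the Cayley graph of $F$ with respect to the generating set $\{x_0,x_1\}$ is strictly greater than $3.5$, that is, $\delta(F;\{x_0,x_1\})>\tfrac{7}{2}$. Equivalently, the Cheeger isoperimetric constant of $F$ with respect to the same generating set is strictly less than $\tfrac12$, that is, $\iota_*(F;\{x_0,x_1\})<\tfrac12$.
   Context: R. Thompson's group $F$ is the group given by the presentation $\langle x_0,x_1,x_2,\ldots \mid x_jx_i=x_ix_{j+1}\ (0\le i<j)\rangle$. Since $x_n=x_0^{-(n-1)}x_1x_0^{n-1}$ for $n\ge 2$, it is generated by $x_0,x_1$. Let $G$ be a group generated by a finite set $A$ with $|A|=m$. The (right) Cayley graph of $G$ with respect to $A$ has vertex set $G$ and, for every $g\in G$ and every one of the $2m$ symbols $a\in A^{\pm1}$, a directed edge labelled $a$ from $g$ to $ga$; its inverse edge is the edge labelled $a^{-1}$ from $ga$ to $g$. (One may equally use the left Cayley graph, in which the edge labelled $a$ starting at $g$ goes to $a^{-1}g$; the quantities below are the same.) A finite nonempty subset $Y\subseteq G$ is identified with the subgraph of the Cayley graph it induces (all edges connecting vertices of $Y$). The density $\delta(Y)$ is the average vertex degree of this subgraph, i.e. $\delta(Y)=\frac{1}{|Y|}\,\#\{(g,a): g\in Y,\ a\in A^{\pm1},\ ga\in Y\}$. The Cheeger boundary $\partial_*Y$ is the set of directed edges from a vertex of $Y$ to a vertex outside $Y$, i.e. $\{(g,a): g\in Y,\ a\in A^{\pm1},\ ga\notin Y\}$, and $\iota_*(Y)=|\partial_*Y|/|Y|$;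 one has $\delta(Y)+\iota_*(Y)=2m$. The density of the Cayley graph is $\delta(G;A)=\sup_Y\delta(Y)$ and the Cheeger isoperimetric constant is $\iota_*(G;A)=\inf_Y\iota_*(Y)$, where $Y$ ranges over all finite nonempty subsets of $G$. *)

theory Defs
  imports Complex_Main "HOL-Algebra.Generated_Groups"
begin

section \<open>Groups given by presentations\<close>

text \<open>A letter \<open>(a, True)\<close> stands for the generator \<open>a\<close> and \<open>(a, False)\<close> for its formal inverse.\<close>

type_synonym 'a word = "('a \<times> bool) list"

text \<open>A defining relation \<open>r = s\<close> is the pair \<open>(r, s)\<close>. All elements of the type \<open>'a\<close> are generators.\<close>

inductive pres_eq :: "('a word \<times> 'a word) set \<Rightarrow> 'a word \<Rightarrow> 'a word \<Rightarrow> bool"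
  for R where
  refl: "pres_eq R u u"
| sym: "pres_eq R u v \<Longrightarrow> pres_eq R v u"
| trans: "pres_eq R u v \<Longrightarrow> pres_eq R v w \<Longrightarrow> pres_eq R u w"
| cancel: "pres_eq R (u @ [(a, e), (a, \<not> e)] @ v) (u @ v)"
| rel: "(r, s) \<in> R \<Longrightarrow> pres_eq R (u @ r @ v) (u @ s @ v)"

definition word_class :: "('a word \<times> 'a word) set \<Rightarrow> 'a word \<Rightarrow> 'a word set" where
  "word_class R u = {v. pres_eq R u v}"

definition presented_group :: "('a word \<times> 'a word) set \<Rightarrow> 'a word set monoid" where
  "presented_group R =
     \<lparr>carrier = range (word_class R),
      mult = (\<lambda>X Y. {w. \<exists>u\<in>X. \<exists>v\<in>Y. pres_eq R (u @ v) w}),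
      one = word_class R []\<rparr>"

lemma pres_eq_append_left: "pres_eq R u v \<Longrightarrow> pres_eq R (t @ u) (t @ v)"
proof (induction rule: pres_eq.induct)
  case (cancel u a e v)
  then show ?case using pres_eq.cancel[of R "t @ u" a e v] by simp
next
  case (rel r s u v)
  then show ?case using pres_eq.rel[of r s R "t @ u" v] by simp
qed (auto intro: pres_eq.intros)

lemma pres_eq_append_right: "pres_eq R u v \<Longrightarrow> pres_eq R (u @ t) (v @ t)"
proof (induction rule: pres_eq.induct)
  case (cancel u a e v)
  then show ?case using pres_eq.cancel[of R u a e "v @ t"] by simp
next
  case (rel r s u v)
  then show ?case using pres_eq.rel[of r s R u "v @ t"] by simp
qed (auto intro: pres_eq.intros)

lemma pres_eq_append: "pres_eq R u u' \<Longrightarrow> pres_eq R v v' \<Longrightarrow> pres_eq R (u @ v) (u' @ v')"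
  by (meson pres_eq.trans pres_eq_append_left pres_eq_append_right)

lemma word_class_eq_iff: "word_class R u = word_class R v \<longleftrightarrow> pres_eq R u v"
  unfolding word_class_def
  by (auto intro: pres_eq.refl pres_eq.sym pres_eq.trans)

lemma presented_group_simps:
  "carrier (presented_group R) = range (word_class R)"
  "\<one>\<^bsub>presented_group R\<^esub> = word_class R []"
  by (simp_all add: presented_group_def)

lemma presented_group_mult:
  "word_class R u \<otimes>\<^bsub>presented_group R\<^esub> word_class R v = word_class R (u @ v)"
  unfolding presented_group_def word_class_def
  by (auto intro: pres_eq.refl pres_eq.sym pres_eq.trans pres_eq_append)

definition inv_word :: "'a word \<Rightarrow> 'a word" where
  "inv_word u = rev (map (\<lambda>(a, e). (a, \<not> e)) u)"

lemma inv_word_left: "pres_eq R (inv_word u @ u) []"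
proof (induction u)
  case Nil
  then show ?case by (simp add: inv_word_def pres_eq.refl)
next
  case (Cons l u)
  obtain a e where l: "l = (a, e)" by (cases l)
  have "pres_eq R (inv_word u @ [(a, \<not> e), (a, \<not> \<not> e)] @ u) (inv_word u @ u)"
    by (rule pres_eq.cancel)
  then have "pres_eq R (inv_word (l # u) @ (l # u)) (inv_word u @ u)"
    by (simp add: inv_word_def l)
  then show ?case using Cons.IH by (rule pres_eq.trans)
qed

lemma group_presented_group: "group (presented_group R)"
proof (rule groupI)
  fix X assume "X \<in> carrier (presented_group R)"
  then obtain u where u: "X = word_class R u" by (auto simp: presented_group_simps)
  have "word_class R (inv_word u) \<otimes>\<^bsub>presented_group R\<^esub> X = \<one>\<^bsub>presented_group R\<^esub>"
    by (simp add: u presented_group_mult presented_group_simps word_class_eq_iff inv_word_left)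
  then show "\<exists>Y\<in>carrier (presented_group R). Y \<otimes>\<^bsub>presented_group R\<^esub> X = \<one>\<^bsub>presented_group R\<^esub>"
    by (auto simp: presented_group_simps)
qed (auto simp: presented_group_simps presented_group_mult)

lemma presented_group_inv:
  "inv\<^bsub>presented_group R\<^esub> (word_class R u) = word_class R (inv_word u)"
proof -
  interpret group "presented_group R" by (rule group_presented_group)
  show ?thesis
    by (rule inv_equality)
      (auto simp: presented_group_simps presented_group_mult word_class_eq_iff inv_word_left)
qed


section \<open>R. Thompson's group \<open>F\<close>\<close>

definition thompson_relations :: "(nat word \<times> nat word) set" where
  "thompson_relations =
     {([(j, True), (i, True)], [(i, True), (Suc j, True)]) | i j. i < j}"

definition thompson_F :: "nat word set monoid" where
  "thompson_F = presented_group thompson_relations"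

definition thompson_x :: "nat \<Rightarrow> nat word set" where
  "thompson_x n = word_class thompson_relations [(n, True)]"

lemma group_thompson_F: "group thompson_F"
  unfolding thompson_F_def by (rule group_presented_group)

lemma thompson_x_in_carrier: "thompson_x n \<in> carrier thompson_F"
  by (simp add: thompson_F_def thompson_x_def presented_group_simps)

lemma thompson_x_relation:
  assumes "i < j"
  shows "thompson_x j \<otimes>\<^bsub>thompson_F\<^esub> thompson_x i = thompson_x i \<otimes>\<^bsub>thompson_F\<^esub> thompson_x (Suc j)"
proof -
  have "([(j, True), (i, True)], [(i, True), (Suc j, True)]) \<in> thompson_relations"
    using assms by (auto simp: thompson_relations_def)
  from pres_eq.rel[OF this, of "[]" "[]"] show ?thesis
    by (simp add: thompson_F_def thompson_x_def presented_group_mult word_class_eq_iff)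
qed

lemma thompson_x_0_neq_1: "thompson_x 0 \<noteq> thompson_x 1"
proof -
  let ?c = "\<lambda>u :: nat word. \<Sum>(n, e)\<leftarrow>u. if n = 0 then (if e then 1 else -1) else (0 :: int)"
  have "?c u = ?c v" if "pres_eq thompson_relations u v" for u v
    using that by (induction rule: pres_eq.induct) (auto simp: thompson_relations_def)
  from this[of "[(0, True)]" "[(1, True)]"] show ?thesis
    by (auto simp: thompson_x_def word_class_eq_iff)
qed

lemma thompson_F_generated: "generate thompson_F {thompson_x 0, thompson_x 1} = carrier thompson_F"
proof -
  interpret group thompson_F by (rule group_thompson_F)
  let ?H = "generate thompson_F {thompson_x 0, thompson_x 1}"
  have sub: "{thompson_x 0, thompson_x 1} \<subseteq> carrier thompson_F"
    by (simp add: thompson_x_in_carrier)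
  have x01: "thompson_x 0 \<in> ?H" "thompson_x 1 \<in> ?H" by (auto intro: generate.incl)
  have step: "thompson_x (Suc (Suc n)) \<in> ?H" if "thompson_x (Suc n) \<in> ?H" for n
  proof -
    have "thompson_x (Suc (Suc n)) =
        inv\<^bsub>thompson_F\<^esub> (thompson_x 0) \<otimes>\<^bsub>thompson_F\<^esub> (thompson_x (Suc n) \<otimes>\<^bsub>thompson_F\<^esub> thompson_x 0)"
      unfolding thompson_x_relation[OF zero_less_Suc]
      by (simp add: inv_solve_left thompson_x_in_carrier)
    then show ?thesis
      using generate.eng[OF generate_m_inv_closed[OF sub x01(1)] generate.eng[OF that x01(1)]]
      by simp
  qed
  have gens: "thompson_x n \<in> ?H" for n
  proof (induction n)
    case (Suc n)
    then show ?case using x01 step by (cases n) auto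
  qed (use x01 in auto)
  have "word_class thompson_relations u \<in> ?H" for u
  proof (induction u)
    case Nil
    have "\<one>\<^bsub>thompson_F\<^esub> \<in> ?H" by (rule generate.one)
    then show ?case by (simp add: thompson_F_def presented_group_simps)
  next
    case (Cons l u)
    obtain n e where l: "l = (n, e)" by (cases l)
    have "word_class thompson_relations [l] \<in> ?H"
    proof (cases e)
      case True
      then show ?thesis using gens[of n] by (simp add: l thompson_x_def)
    next
      case False
      have "inv\<^bsub>thompson_F\<^esub> (thompson_x n) = word_class thompson_relations [l]"
        using False by (simp add: l thompson_F_def thompson_x_def presented_group_inv inv_word_def)
      then show ?thesis using generate_m_inv_closed[OF sub gens[of n]] by simp
    qed
    then have "word_class thompson_relations [l] \<otimes>\<^bsub>thompson_F\<^esub> word_class thompson_relations u \<in> ?H"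
      using Cons.IH by (rule generate.eng)
    then show ?case by (simp add: thompson_F_def presented_group_mult)
  qed
  then have "carrier thompson_F \<subseteq> ?H"
    by (auto simp: thompson_F_def presented_group_simps)
  then show ?thesis using generate_incl[OF sub] by blast
qed


section \<open>Density and Cheeger constant of Cayley graphs\<close>

text \<open>The symbols labelling edges are formal, so \<open>(a, True)\<close> and \<open>(a, False)\<close> count as two symbols
  even when they denote the same group element.\<close>

definition symbols :: "'a set \<Rightarrow> ('a \<times> bool) set" where
  "symbols A = A \<times> UNIV"

definition symbol_value :: "('a, 'b) monoid_scheme \<Rightarrow> 'a \<times> bool \<Rightarrow> 'a" where
  "symbol_value G s = (if snd s then fst s else inv\<^bsub>G\<^esub> (fst s))"

definition internal_edges ::
    "('a, 'b) monoid_scheme \<Rightarrow> 'a set \<Rightarrow> 'a set \<Rightarrow> ('a \<times> 'a \<times> bool) set" where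
  "internal_edges G A Y = {(g, s). g \<in> Y \<and> s \<in> symbols A \<and> g \<otimes>\<^bsub>G\<^esub> symbol_value G s \<in> Y}"

definition cheeger_boundary ::
    "('a, 'b) monoid_scheme \<Rightarrow> 'a set \<Rightarrow> 'a set \<Rightarrow> ('a \<times> 'a \<times> bool) set" where
  "cheeger_boundary G A Y = {(g, s). g \<in> Y \<and> s \<in> symbols A \<and> g \<otimes>\<^bsub>G\<^esub> symbol_value G s \<notin> Y}"

definition subset_density :: "('a, 'b) monoid_scheme \<Rightarrow> 'a set \<Rightarrow> 'a set \<Rightarrow> real" where
  "subset_density G A Y = real (card (internal_edges G A Y)) / real (card Y)"

definition subset_cheeger :: "('a, 'b) monoid_scheme \<Rightarrow> 'a set \<Rightarrow> 'a set \<Rightarrow> real" where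
  "subset_cheeger G A Y = real (card (cheeger_boundary G A Y)) / real (card Y)"

definition finite_subgraphs :: "('a, 'b) monoid_scheme \<Rightarrow> 'a set set" where
  "finite_subgraphs G = {Y. Y \<subseteq> carrier G \<and> finite Y \<and> Y \<noteq> {}}"

definition cayley_density :: "('a, 'b) monoid_scheme \<Rightarrow> 'a set \<Rightarrow> real" where
  "cayley_density G A = (SUP Y\<in>finite_subgraphs G. subset_density G A Y)"

definition cheeger_constant :: "('a, 'b) monoid_scheme \<Rightarrow> 'a set \<Rightarrow> real" where
  "cheeger_constant G A = (INF Y\<in>finite_subgraphs G. subset_cheeger G A Y)"

text \<open>The supremum and infimum are taken in the reals; the following facts show that both are over
  bounded sets, so they are genuine.\<close>

lemma subset_density_add_cheeger:
  assumes "finite A" and "Y \<in> finite_subgraphs G"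
  shows "subset_density G A Y + subset_cheeger G A Y = 2 * real (card A)"
proof -
  have Y: "finite Y" "card Y > 0" using assms(2) by (auto simp: finite_subgraphs_def card_gt_0_iff)
  have un: "internal_edges G A Y \<union> cheeger_boundary G A Y = Y \<times> symbols A"
    by (auto simp: internal_edges_def cheeger_boundary_def)
  have fin: "finite (Y \<times> symbols A)" using assms(1) Y by (simp add: symbols_def)
  have "card (internal_edges G A Y) + card (cheeger_boundary G A Y) = card (Y \<times> symbols A)"
    unfolding un[symmetric]
  proof (rule card_Un_disjoint[symmetric])
    show "finite (internal_edges G A Y)" "finite (cheeger_boundary G A Y)"
      using fin unfolding un[symmetric] by simp_all
  qed (auto simp: internal_edges_def cheeger_boundary_def)
  also have "\<dots> = card Y * (2 * card A)"
    by (simp add: symbols_def card_cartesian_product)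
  finally have "real (card (internal_edges G A Y)) + real (card (cheeger_boundary G A Y))
      = real (card Y) * (2 * real (card A))"
    by (simp flip: of_nat_add)
  then show ?thesis
    using Y(2) unfolding subset_density_def subset_cheeger_def add_divide_distrib[symmetric]
    by (simp del: card_gt_0_iff)
qed

lemma bdd_above_subset_density:
  assumes "finite A"
  shows "bdd_above (subset_density G A ` finite_subgraphs G)"
proof (rule bdd_aboveI2)
  fix Y assume "Y \<in> finite_subgraphs G"
  moreover have "subset_cheeger G A Y \<ge> 0" by (simp add: subset_cheeger_def)
  ultimately show "subset_density G A Y \<le> 2 * real (card A)"
    using subset_density_add_cheeger[OF assms] by (metis add_increasing2 order_refl)
qed

lemma bdd_below_subset_cheeger: "bdd_below (subset_cheeger G A ` finite_subgraphs G)"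
  by (rule bdd_belowI2[of _ 0]) (simp add: subset_cheeger_def)

end

theory Submission imports Defs begin

text \<open>Elements of \<open>F\<close> are represented by pointed binary forests: \<open>x\<^sub>0\<close> moves the pointer and \<open>x\<^sub>1\<close>
  splits the pointed tree, so the missing edges of the Belk--Brown set (trees of height at most
  \<open>k + 1\<close>) come from pointed leaves (no split) and from trees of full height at or just after the
  pointer (no join). Weight a forest by \<open>z\<close> to the number of its leaves, with \<open>z\<close> such that the trees
  have total weight \<open>1\<close>: each of the two defects has probability \<open>z\<close>, which tends to \<open>1/4\<close> as \<open>k\<close> grows,
  and this gives the Cheeger ratio \<open>1/2\<close> in the limit. At a run leaf, full, leaf, full the first three
  pointer positions span a subgraph with \<open>5\<close> missing edges and only \<open>3\<close> edges leaving it; lowering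
  the weight there saves \<open>5 - 3 = 2\<close> units of boundary for \<open>3\<close> units of mass, which beats the ratio
  \<open>1/2\<close>, and such runs have a probability bounded away from \<open>0\<close>.\<close>

section \<open>Isoperimetry of functions\<close>

text \<open>Points of \<open>X\<close> without an image in \<open>Y\<close> contribute
  \<open>0\<close>. On the others \<open>m\<close> is injective with values in \<open>Z\<close>, so
  the sum reindexes to a part of the sum over \<open>Z\<close>.\<close>

lemma sum_partial_inj_le:
  fixes f :: "'b \<Rightarrow> real"
  assumes "finite X" "finite Y" "\<And>y. y \<in> Y \<Longrightarrow> f y \<ge> 0" "\<And>y. y \<notin> Y \<Longrightarrow> f y = 0"
    and inj: "\<And>x x' y. m x = Some y \<Longrightarrow> m x' = Some y \<Longrightarrow> x = x'"
    and sub: "\<And>x y. x \<in> X \<Longrightarrow> m x = Some y \<Longrightarrow> y \<in> Y \<Longrightarrow> y \<in> Z"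
    and "Z \<subseteq> Y"
  shows "(\<Sum>x\<in>X. case_option 0 f (m x)) \<le> sum f Z"
proof -
  let ?X = "{x \<in> X. \<exists>y\<in>Y. m x = Some y}"
  have "(\<Sum>x\<in>X. case_option 0 f (m x)) = (\<Sum>x\<in>?X. case_option 0 f (m x))"
    using assms(1,4) by (intro sum.mono_neutral_right) (auto split: option.splits)
  also have "\<dots> = (\<Sum>x\<in>?X. f (the (m x)))"
    by (intro sum.cong) auto
  also have "\<dots> = sum f ((\<lambda>x. the (m x)) ` ?X)"
    by (subst sum.reindex) (auto intro!: inj_onI intro: inj)
  also have "\<dots> \<le> sum f Z"
    using assms finite_subset[OF \<open>Z \<subseteq> Y\<close>] by (intro sum_mono2) auto
  finally show ?thesis .
qed

text \<open>Layer-cake decomposition: peel off the minimal positive value of \<open>\<psi>\<close> on its support.\<close>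

lemma function_isoperimetry:
  fixes \<psi> :: "'a \<Rightarrow> real" and h :: real
  assumes A: "finite A"
    and iso: "\<And>S. S \<in> finite_subgraphs G \<Longrightarrow> h * card S \<le> card (cheeger_boundary G A S)"
    and "finite X" "X \<subseteq> carrier G" "\<And>g. g \<in> X \<Longrightarrow> \<psi> g > 0" "\<And>g. g \<notin> X \<Longrightarrow> \<psi> g = 0"
  shows "h * sum \<psi> X \<le> (\<Sum>g\<in>X. \<Sum>s\<in>symbols A. max 0 (\<psi> g - \<psi> (g \<otimes>\<^bsub>G\<^esub> symbol_value G s)))"
  using assms(3-6)
proof (induction X arbitrary: \<psi> rule: finite_psubset_induct)
  case (psubset X)
  show ?case
  proof (cases "X = {}")
    case False
    define m where "m = Min (\<psi> ` X)"
    define \<psi>' where "\<psi>' g = (if g \<in> X then \<psi> g - m else 0)" for g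
    define X' where "X' = {g \<in> X. \<psi> g > m}"
    have m: "m \<le> \<psi> g" if "g \<in> X" for g using that psubset.hyps by (simp add: m_def)
    have "m \<in> \<psi> ` X" unfolding m_def using psubset.hyps False by (intro Min_in) auto
    then obtain g0 where g0: "g0 \<in> X" "\<psi> g0 = m" by auto
    have m0: "m > 0" using g0 psubset.prems by auto
    let ?D = "\<lambda>\<psi> g s. max 0 (\<psi> g - \<psi> (g \<otimes>\<^bsub>G\<^esub> symbol_value G s))"
    let ?b = "\<lambda>g s. of_bool (g \<otimes>\<^bsub>G\<^esub> symbol_value G s \<notin> X) :: real"
    have IH: "h * sum \<psi>' X' \<le> (\<Sum>g\<in>X'. \<Sum>s\<in>symbols A. ?D \<psi>' g s)"
      using psubset.prems g0 m0
      by (intro psubset.IH) (auto simp: X'_def \<psi>'_def dest: m)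
    have s1: "sum \<psi>' X = sum \<psi>' X'"
      using psubset.hyps m by (intro sum.mono_neutral_right) (force simp: X'_def \<psi>'_def)+
    have s2: "sum \<psi> X = sum \<psi>' X + m * card X"
      by (simp add: \<psi>'_def sum_subtractf)
    have fs: "finite (symbols A)" using A by (simp add: symbols_def)
    have bd: "(\<Sum>g\<in>X. \<Sum>s\<in>symbols A. ?b g s) = card (cheeger_boundary G A X)"
    proof -
      have "cheeger_boundary G A X
          = Sigma X (\<lambda>g. {s \<in> symbols A. g \<otimes>\<^bsub>G\<^esub> symbol_value G s \<notin> X})"
        by (auto simp: cheeger_boundary_def)
      then show ?thesis
        using psubset.hyps fs by (simp add: sum.inter_filter[symmetric] of_bool_def)
    qed
    have "X \<in> finite_subgraphs G"
      using psubset False by (auto simp: finite_subgraphs_def)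
    then have "h * card X \<le> (\<Sum>g\<in>X. \<Sum>s\<in>symbols A. ?b g s)" using iso bd by metis
    then have "m * (h * card X) \<le> m * (\<Sum>g\<in>X. \<Sum>s\<in>symbols A. ?b g s)"
      using m0 by (intro mult_left_mono) auto
    moreover have "(\<Sum>g\<in>X'. \<Sum>s\<in>symbols A. ?D \<psi>' g s) \<le> (\<Sum>g\<in>X. \<Sum>s\<in>symbols A. ?D \<psi>' g s)"
      using psubset.hyps by (intro sum_mono2) (auto simp: X'_def intro!: sum_nonneg)
    \<comment> \<open>Along an edge inside \<open>X\<close> both values are lowered by
      \<open>m\<close>; along an edge leaving \<open>X\<close> the target has value
      \<open>0\<close>, and the drop shrinks by exactly \<open>m\<close>.\<close>
    moreover have "?D \<psi> g s = ?D \<psi>' g s + m * ?b g s" if "g \<in> X" for g s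
      using that m[OF that] m0 psubset.prems by (auto simp: \<psi>'_def)
    then have "(\<Sum>g\<in>X. \<Sum>s\<in>symbols A. ?D \<psi> g s)
        = (\<Sum>g\<in>X. \<Sum>s\<in>symbols A. ?D \<psi>' g s) + m * (\<Sum>g\<in>X. \<Sum>s\<in>symbols A. ?b g s)"
      by (simp add: sum.distrib sum_distrib_left)
    ultimately show ?thesis using IH s1 s2 by (simp add: algebra_simps)
  qed simp
qed

text \<open>The partial maps \<open>m s\<close> need not come from a subset of the Cayley graph: \<open>\<phi>\<close> may identify points
  of \<open>Y\<close>, because the total variation does not increase under push-forward.\<close>

lemma isoperimetric_set_from_partial_action:
  fixes f :: "'y \<Rightarrow> real" and h :: real
  assumes A: "finite A" and Y: "finite Y" "\<And>y. y \<in> Y \<Longrightarrow> f y \<ge> 0" "\<And>y. y \<notin> Y \<Longrightarrow> f y = 0"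
    and \<phi>: "\<And>y. y \<in> Y \<Longrightarrow> \<phi> y \<in> carrier G"
    and inj: "\<And>s x x' y. m s x = Some y \<Longrightarrow> m s x' = Some y \<Longrightarrow> x = x'"
    and equiv: "\<And>s x y. s \<in> symbols A \<Longrightarrow> x \<in> Y \<Longrightarrow> y \<in> Y \<Longrightarrow> m s x = Some y
      \<Longrightarrow> \<phi> y = \<phi> x \<otimes>\<^bsub>G\<^esub> symbol_value G s"
    and small: "(\<Sum>s\<in>symbols A. \<Sum>y\<in>Y. max 0 (f y - case_option 0 f (m s y))) < h * sum f Y"
  shows "\<exists>S\<in>finite_subgraphs G. card (cheeger_boundary G A S) < h * card S"
proof (rule ccontr)
  assume "\<not> ?thesis"
  then have iso: "\<And>S. S \<in> finite_subgraphs G \<Longrightarrow> h * card S \<le> card (cheeger_boundary G A S)"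
    by force
  \<comment> \<open>\<open>\<psi>\<close> is the push-forward of \<open>f\<close> along
    \<open>\<phi>\<close>. Under the assumed failure every finite set satisfies the isoperimetric
    inequality, hence so does \<open>\<psi>\<close>.\<close>
  define \<psi> where "\<psi> g = (\<Sum>y\<in>{y \<in> Y. \<phi> y = g}. f y)" for g
  define X where "X = {g \<in> \<phi> ` Y. \<psi> g > 0}"
  let ?v = "symbol_value G"
  have \<psi>0: "\<psi> g \<ge> 0" for g unfolding \<psi>_def using Y by (intro sum_nonneg) blast
  have out: "\<psi> g = 0" if "g \<notin> X" for g
  proof (cases "g \<in> \<phi> ` Y")
    case True then show ?thesis using that \<psi>0[of g] by (auto simp: X_def)
  next
    case False
    then show ?thesis unfolding \<psi>_def by (intro sum.neutral) auto
  qed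
  have X: "finite X" "X \<subseteq> \<phi> ` Y" using Y by (auto simp: X_def)
  have "h * sum \<psi> X \<le> (\<Sum>g\<in>X. \<Sum>s\<in>symbols A. max 0 (\<psi> g - \<psi> (g \<otimes>\<^bsub>G\<^esub> ?v s)))"
  proof (rule function_isoperimetry[OF A iso \<open>finite X\<close> _ _ out])
    show "X \<subseteq> carrier G" using X \<phi> by blast
    show "\<psi> g > 0" if "g \<in> X" for g using that by (simp add: X_def)
  qed
  also have "\<dots> \<le> (\<Sum>g\<in>\<phi> ` Y. \<Sum>s\<in>symbols A. max 0 (\<psi> g - \<psi> (g \<otimes>\<^bsub>G\<^esub> ?v s)))"
  proof (rule sum_mono2)
    show "0 \<le> (\<Sum>s\<in>symbols A. max 0 (\<psi> g - \<psi> (g \<otimes>\<^bsub>G\<^esub> ?v s)))" for g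
      by (intro sum_nonneg) simp
  qed (use X Y in auto)
  also have "\<dots> \<le> (\<Sum>g\<in>\<phi> ` Y. \<Sum>s\<in>symbols A. \<Sum>y\<in>{y \<in> Y. \<phi> y = g}.
      max 0 (f y - case_option 0 f (m s y)))"
  proof (intro sum_mono)
    fix g s assume s: "s \<in> symbols A" and g: "g \<in> \<phi> ` Y"
    let ?Z = "{y \<in> Y. \<phi> y = g}"
    \<comment> \<open>The move \<open>m s\<close> sends the fibre over \<open>g\<close> injectively
      into the fibre over its neighbour, or out of \<open>Y\<close>, where \<open>f\<close>
      vanishes.\<close>
    have "(\<Sum>y\<in>?Z. case_option 0 f (m s y)) \<le> sum f {y \<in> Y. \<phi> y = g \<otimes>\<^bsub>G\<^esub> ?v s}"
    proof (rule sum_partial_inj_le[where Y = Y])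
      show "x = x'" if "m s x = Some y" "m s x' = Some y" for x x' y
        using that by (rule inj)
      show "y \<in> {y \<in> Y. \<phi> y = g \<otimes>\<^bsub>G\<^esub> ?v s}"
        if "x \<in> ?Z" "m s x = Some y" "y \<in> Y" for x y
        using that equiv[OF s, of x y] by simp
    qed (use Y in auto)
    then have "\<psi> g - \<psi> (g \<otimes>\<^bsub>G\<^esub> ?v s) \<le> (\<Sum>y\<in>?Z. f y - case_option 0 f (m s y))"
      by (simp add: \<psi>_def sum_subtractf)
    also have "\<dots> \<le> (\<Sum>y\<in>?Z. max 0 (f y - case_option 0 f (m s y)))"
      by (intro sum_mono) auto
    finally show "max 0 (\<psi> g - \<psi> (g \<otimes>\<^bsub>G\<^esub> ?v s)) \<le> \<dots>"
      by (auto intro: sum_nonneg)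
  qed
  also have "\<dots> = (\<Sum>s\<in>symbols A. \<Sum>g\<in>\<phi> ` Y. \<Sum>y\<in>{y \<in> Y. \<phi> y = g}.
      max 0 (f y - case_option 0 f (m s y)))"
    by (rule sum.swap)
  also have "\<dots> = (\<Sum>s\<in>symbols A. \<Sum>y\<in>Y. max 0 (f y - case_option 0 f (m s y)))"
    by (rule sum.cong[OF HOL.refl], rule sum.image_gen[symmetric], rule Y)
  finally have "h * sum \<psi> X \<le> \<dots>" .
  moreover have "sum \<psi> X = sum \<psi> (\<phi> ` Y)"
    using X Y out by (intro sum.mono_neutral_left) auto
  moreover have "\<dots> = sum f Y"
    unfolding \<psi>_def by (rule sum.image_gen[symmetric], rule Y)
  ultimately show False using small by simp
qed

lemma thompson_density_cheeger:
  fixes d :: real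
  assumes "S \<in> finite_subgraphs thompson_F"
    and "card (cheeger_boundary thompson_F {thompson_x 0, thompson_x 1} S) < d * card S"
  shows "cayley_density thompson_F {thompson_x 0, thompson_x 1} > 4 - d \<and>
         cheeger_constant thompson_F {thompson_x 0, thompson_x 1} < d"
proof -
  let ?A = "{thompson_x 0, thompson_x 1}"
  have S: "card S > 0" using assms(1) by (auto simp: finite_subgraphs_def card_gt_0_iff)
  then have lt: "subset_cheeger thompson_F ?A S < d"
    using assms(2) by (simp add: subset_cheeger_def field_simps)
  have "cheeger_constant thompson_F ?A \<le> subset_cheeger thompson_F ?A S"
    unfolding cheeger_constant_def by (intro cINF_lower bdd_below_subset_cheeger assms)
  moreover have "subset_density thompson_F ?A S \<le> cayley_density thompson_F ?A"
    unfolding cayley_density_def by (intro cSUP_upper bdd_above_subset_density assms) auto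
  \<comment> \<open>The degree is \<open>4\<close> because the two generators are distinct.\<close>
  moreover have "subset_density thompson_F ?A S + subset_cheeger thompson_F ?A S = 4"
    using subset_density_add_cheeger[of ?A S thompson_F] assms(1) thompson_x_0_neq_1 by simp
  ultimately show ?thesis using lt by linarith
qed

section \<open>Pointed binary forests and their moves\<close>

datatype tree = Leaf | Node tree tree

text \<open>In \<open>(L, c, R)\<close> the pointer is at \<open>c\<close>; \<open>L\<close> lists the trees to its left, nearest first.\<close>

type_synonym forest = "tree list \<times> tree \<times> tree list"

fun move_right :: "forest \<Rightarrow> forest option" where
  "move_right (L, c, d # R) = Some (c # L, d, R)"
| "move_right (L, c, []) = None"

fun move_left :: "forest \<Rightarrow> forest option" where
  "move_left (d # L, c, R) = Some (L, d, c # R)"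
| "move_left ([], c, R) = None"

fun join :: "forest \<Rightarrow> forest option" where
  "join (L, c, d # R) = Some (L, Node c d, R)"
| "join (L, c, []) = None"

fun split :: "forest \<Rightarrow> forest option" where
  "split (L, Node c d, R) = Some (L, c, d # R)"
| "split (L, Leaf, R) = None"

lemma move_right_iff: "move_right y = Some y' \<longleftrightarrow> move_left y' = Some y"
  by (cases y rule: move_right.cases; cases y' rule: move_left.cases) auto

lemma join_iff: "join y = Some y' \<longleftrightarrow> split y' = Some y"
  by (cases y rule: join.cases; cases y' rule: split.cases) auto

text \<open>Each of the four moves is undone by another one of them.\<close>

lemma moves_inj:
  assumes "m \<in> {move_right, move_left, join, split}" "m x = Some y" "m x' = Some y"
  shows "x = x'"
proof -
  from assms(1) consider "m = move_right" | "m = move_left" | "m = join" | "m = split" by blast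
  then show ?thesis
  proof cases
    case 1
    then show ?thesis using assms(2,3) by (simp add: move_right_iff)
  next
    case 2
    then show ?thesis using assms(2,3) by (simp flip: move_right_iff)
  next
    case 3
    then show ?thesis using assms(2,3) by (simp add: join_iff)
  next
    case 4
    then show ?thesis using assms(2,3) by (simp flip: join_iff)
  qed
qed

section \<open>From pointed forests to elements of \<open>F\<close>\<close>

abbreviation y_elt :: "nat \<Rightarrow> nat word set" where
  "y_elt n \<equiv> inv\<^bsub>thompson_F\<^esub> (thompson_x n)"

text \<open>Read from left to right, the product is a recipe on a row of trees: build
  \<open>l\<close> at position \<open>n\<close> and \<open>r\<close> at position
  \<open>n + 1\<close>, then join the two by \<open>y_elt n\<close>.\<close>

fun tree_elt :: "nat \<Rightarrow> tree \<Rightarrow> nat word set" where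
  "tree_elt n Leaf = \<one>\<^bsub>thompson_F\<^esub>"
| "tree_elt n (Node l r) = tree_elt n l \<otimes>\<^bsub>thompson_F\<^esub> (tree_elt (Suc n) r \<otimes>\<^bsub>thompson_F\<^esub> y_elt n)"

fun right_elt :: "nat \<Rightarrow> tree list \<Rightarrow> nat word set" where
  "right_elt n [] = \<one>\<^bsub>thompson_F\<^esub>"
| "right_elt n (t # R) = tree_elt n t \<otimes>\<^bsub>thompson_F\<^esub> right_elt (Suc n) R"

fun left_elt :: "tree list \<Rightarrow> nat word set" where
  "left_elt [] = \<one>\<^bsub>thompson_F\<^esub>"
| "left_elt (t # L) = left_elt L \<otimes>\<^bsub>thompson_F\<^esub> (tree_elt 1 t \<otimes>\<^bsub>thompson_F\<^esub> y_elt 0)"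

text \<open>Tree number \<open>0\<close> of the underlying forest is the left vine on an extra leaf and the trees of \<open>L\<close>,
  so the pointed tree has number \<open>1\<close>.\<close>

fun forest_elt :: "forest \<Rightarrow> nat word set" where
  "forest_elt (L, c, R) = left_elt L \<otimes>\<^bsub>thompson_F\<^esub> (tree_elt 1 c \<otimes>\<^bsub>thompson_F\<^esub> right_elt 2 R)"

context begin

interpretation F: group thompson_F by (rule group_thompson_F)

lemma y_elt_closed [simp]: "y_elt n \<in> carrier thompson_F"
  by (simp add: thompson_x_in_carrier)

lemma tree_elt_closed [simp]: "tree_elt n t \<in> carrier thompson_F"
  by (induction t arbitrary: n) auto

lemma right_elt_closed [simp]: "right_elt n R \<in> carrier thompson_F"
  by (induction R arbitrary: n) auto

lemma left_elt_closed [simp]: "left_elt L \<in> carrier thompson_F"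
  by (induction L) auto

lemma forest_elt_closed [simp]: "forest_elt y \<in> carrier thompson_F"
  by (cases y) auto

text \<open>These are the inverted defining relations. In terms of forests, a join at position
  \<open>i\<close> lowers the positions of the trees further right by one.\<close>

lemma y_elt_swap:
  assumes "i < j"
  shows "y_elt (Suc j) \<otimes>\<^bsub>thompson_F\<^esub> y_elt i = y_elt i \<otimes>\<^bsub>thompson_F\<^esub> y_elt j"
  using arg_cong[OF thompson_x_relation[OF assms], of "m_inv thompson_F"]
  by (simp add: F.inv_mult_group thompson_x_in_carrier)

lemma tree_elt_swap:
  assumes "i < n"
  shows "tree_elt (Suc n) t \<otimes>\<^bsub>thompson_F\<^esub> y_elt i = y_elt i \<otimes>\<^bsub>thompson_F\<^esub> tree_elt n t"
  using assms
proof (induction t arbitrary: n)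
  case (Node l r)
  let ?m = "mult thompson_F"
  have "tree_elt (Suc n) (Node l r) \<otimes>\<^bsub>thompson_F\<^esub> y_elt i
      = ?m (tree_elt (Suc n) l) (?m (tree_elt (Suc (Suc n)) r) (?m (y_elt (Suc n)) (y_elt i)))"
    by (simp add: F.m_assoc)
  also have "\<dots> = ?m (tree_elt (Suc n) l) (?m (?m (tree_elt (Suc (Suc n)) r) (y_elt i)) (y_elt n))"
    using Node.prems by (simp add: y_elt_swap F.m_assoc)
  also have "\<dots> = ?m (?m (tree_elt (Suc n) l) (y_elt i)) (?m (tree_elt (Suc n) r) (y_elt n))"
    using Node.prems Node.IH(2)[of "Suc n"] by (simp add: F.m_assoc)
  also have "\<dots> = ?m (y_elt i) (tree_elt n (Node l r))"
    using Node.prems Node.IH(1)[of n] by (simp add: F.m_assoc)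
  finally show ?case .
qed simp

lemma right_elt_swap:
  assumes "i < n"
  shows "right_elt (Suc n) R \<otimes>\<^bsub>thompson_F\<^esub> y_elt i = y_elt i \<otimes>\<^bsub>thompson_F\<^esub> right_elt n R"
  using assms
proof (induction R arbitrary: n)
  case (Cons t R)
  let ?m = "mult thompson_F"
  have "right_elt (Suc n) (t # R) \<otimes>\<^bsub>thompson_F\<^esub> y_elt i
      = ?m (tree_elt (Suc n) t) (?m (right_elt (Suc (Suc n)) R) (y_elt i))"
    by (simp add: F.m_assoc)
  also have "\<dots> = ?m (?m (tree_elt (Suc n) t) (y_elt i)) (right_elt (Suc n) R)"
    using Cons.prems Cons.IH[of "Suc n"] by (simp add: F.m_assoc)
  also have "\<dots> = ?m (y_elt i) (right_elt n (t # R))"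
    using Cons.prems by (simp add: tree_elt_swap F.m_assoc)
  finally show ?case .
qed simp

text \<open>Moving right hangs the pointed tree onto the left vine, that is, it joins trees
  \<open>0\<close> and \<open>1\<close>. The factor \<open>y_elt 0\<close> travels left past the
  trees after the old pointer and renumbers them.\<close>

lemma forest_elt_move_right:
  assumes "move_right y = Some y'"
  shows "forest_elt y' = forest_elt y \<otimes>\<^bsub>thompson_F\<^esub> y_elt 0"
proof -
  let ?m = "mult thompson_F"
  obtain L c d R where y: "y = (L, c, d # R)" "y' = (c # L, d, R)"
    using assms by (cases y rule: move_right.cases) auto
  have "?m (forest_elt y) (y_elt 0)
      = ?m (left_elt L) (?m (tree_elt 1 c) (?m (tree_elt 2 d) (?m (right_elt (Suc 2) R) (y_elt 0))))"
    by (simp add: y F.m_assoc numeral_eq_Suc)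
  also have "\<dots> = ?m (left_elt L) (?m (tree_elt 1 c) (?m (?m (tree_elt (Suc 1) d) (y_elt 0)) (right_elt 2 R)))"
    by (subst right_elt_swap) (simp_all add: F.m_assoc numeral_eq_Suc)
  also have "\<dots> = forest_elt y'"
    by (subst tree_elt_swap) (simp_all add: y F.m_assoc numeral_eq_Suc)
  finally show ?thesis ..
qed

text \<open>Here trees \<open>1\<close> and \<open>2\<close> are joined, so \<open>y_elt 1\<close>
  only has to pass the trees beyond them.\<close>

lemma forest_elt_join:
  assumes "join y = Some y'"
  shows "forest_elt y' = forest_elt y \<otimes>\<^bsub>thompson_F\<^esub> y_elt 1"
proof -
  let ?m = "mult thompson_F"
  obtain L c d R where y: "y = (L, c, d # R)" "y' = (L, Node c d, R)"
    using assms by (cases y rule: join.cases) auto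
  have "?m (forest_elt y) (y_elt 1)
      = ?m (left_elt L) (?m (tree_elt 1 c) (?m (tree_elt 2 d) (?m (right_elt (Suc 2) R) (y_elt 1))))"
    by (simp add: y F.m_assoc numeral_eq_Suc)
  also have "\<dots> = forest_elt y'"
    by (subst right_elt_swap) (simp_all add: y F.m_assoc numeral_eq_Suc)
  finally show ?thesis ..
qed

lemma forest_elt_move_left:
  assumes "move_left y = Some y'"
  shows "forest_elt y' = forest_elt y \<otimes>\<^bsub>thompson_F\<^esub> thompson_x 0"
  using forest_elt_move_right[of y' y] assms
  by (simp add: move_right_iff F.m_assoc thompson_x_in_carrier)

lemma forest_elt_split:
  assumes "split y = Some y'"
  shows "forest_elt y' = forest_elt y \<otimes>\<^bsub>thompson_F\<^esub> thompson_x 1"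
  using forest_elt_join[of y' y] assms
  by (simp add: join_iff F.m_assoc thompson_x_in_carrier)

end

definition total_variation :: "forest set \<Rightarrow> (forest \<Rightarrow> forest option) \<Rightarrow> (forest \<Rightarrow> real) \<Rightarrow> real" where
  "total_variation Y m f = (\<Sum>y\<in>Y. max 0 (f y - case_option 0 f (m y)))"

lemma thompson_set_from_forests:
  fixes h :: real
  assumes "finite Y" "\<And>y. y \<in> Y \<Longrightarrow> f y \<ge> 0" "\<And>y. y \<notin> Y \<Longrightarrow> f y = 0"
    and small: "total_variation Y move_right f + total_variation Y move_left f
      + total_variation Y join f + total_variation Y split f < h * sum f Y"
  shows "\<exists>S\<in>finite_subgraphs thompson_F.
    card (cheeger_boundary thompson_F {thompson_x 0, thompson_x 1} S) < h * card S"
proof -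
  let ?A = "{thompson_x 0, thompson_x 1}"
  \<comment> \<open>Forests are built from inverse generators, so the inverses move right and join,
    while the generators themselves move left and split. The nested conditionals make
    \<open>m s\<close> one of the four moves for every \<open>s\<close>, as injectivity is required
    for all \<open>s\<close>.\<close>
  define m where "m s = (if fst s = thompson_x 0
    then if snd s then move_left else move_right else if snd s then split else join)" for s
  have m: "m (thompson_x 0, False) = move_right" "m (thompson_x 0, True) = move_left"
    "m (thompson_x 1, False) = join" "m (thompson_x 1, True) = split"
    using thompson_x_0_neq_1 thompson_x_0_neq_1[symmetric] by (simp_all add: m_def del: One_nat_def)
  have sym: "symbols ?A = {(thompson_x 0, False), (thompson_x 0, True),
      (thompson_x 1, False), (thompson_x 1, True)}"
    by (auto simp: symbols_def)
  show ?thesis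
  proof (rule isoperimetric_set_from_partial_action[where Y = Y and f = f and \<phi> = forest_elt and m = m])
    show "x = x'" if "m s x = Some y" "m s x' = Some y" for s x x' y
      by (rule moves_inj[OF _ that]) (simp add: m_def)
    show "forest_elt y = forest_elt x \<otimes>\<^bsub>thompson_F\<^esub> symbol_value thompson_F s"
      if s: "s \<in> symbols ?A" and y: "m s x = Some y" for s x y
    proof -
      from s consider "s = (thompson_x 0, False)" | "s = (thompson_x 0, True)"
        | "s = (thompson_x 1, False)" | "s = (thompson_x 1, True)"
        unfolding sym by blast
      then show ?thesis
      proof cases
        case 1
        show ?thesis using y forest_elt_move_right unfolding 1 m symbol_value_def fst_conv snd_conv by simp
      next
        case 2
        show ?thesis using y forest_elt_move_left unfolding 2 m symbol_value_def fst_conv snd_conv by simp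
      next
        case 3
        show ?thesis using y forest_elt_join unfolding 3 m symbol_value_def fst_conv snd_conv by simp
      next
        case 4
        show ?thesis using y forest_elt_split unfolding 4 m symbol_value_def fst_conv snd_conv by simp
      qed
    qed
    have "sum g (symbols ?A) = g (thompson_x 0, False) + g (thompson_x 0, True)
        + g (thompson_x 1, False) + g (thompson_x 1, True)" for g :: "_ \<Rightarrow> real"
    proof -
      have "(\<Sum>a\<in>?A. \<Sum>e\<in>UNIV. g (a, e)) = sum g (symbols ?A)"
        by (simp add: symbols_def sum.cartesian_product)
      then show ?thesis using thompson_x_0_neq_1 by (simp add: UNIV_bool)
    qed
    then show "(\<Sum>s\<in>symbols ?A. \<Sum>y\<in>Y. max 0 (f y - case_option 0 f (m s y))) < h * sum f Y"
      using small by (simp only: m total_variation_def)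
  qed (use assms in auto)
qed

section \<open>A weighted box of pointed forests\<close>

fun wt :: "real \<Rightarrow> tree \<Rightarrow> real" where
  "wt z Leaf = z"
| "wt z (Node l r) = wt z l * wt z r"

abbreviation wts :: "real \<Rightarrow> tree list \<Rightarrow> real" where
  "wts z L \<equiv> prod_list (map (wt z) L)"

fun weight :: "real \<Rightarrow> forest \<Rightarrow> real" where
  "weight z (L, c, R) = wts z L * (wt z c * wts z R)"

text \<open>All four moves preserve the number of leaves.\<close>

lemma weight_move:
  assumes "m \<in> {move_right, move_left, join, split}" "m y = Some y'"
  shows "weight z y' = weight z y"
proof -
  have "weight z y' = weight z y" if "move_right y = Some y'" for y y'
    using that by (cases y rule: move_right.cases) (auto simp: algebra_simps)
  moreover have "weight z y' = weight z y" if "join y = Some y'" for y y'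
    using that by (cases y rule: join.cases) (auto simp: algebra_simps)
  ultimately show ?thesis
    using assms move_right_iff[of y' y] join_iff[of y' y] by (elim insertE) simp_all
qed

fun trees :: "nat \<Rightarrow> tree set" where
  "trees 0 = {Leaf}"
| "trees (Suc k) = insert Leaf (case_prod Node ` (trees k \<times> trees k))"

lemma finite_trees [simp]: "finite (trees k)"
  by (induction k) auto

lemma Leaf_in_trees [simp]: "Leaf \<in> trees k"
  by (cases k) auto

lemma trees_mono: "trees k \<subseteq> trees (Suc k)"
  by (induction k) auto

lemma sum_trees_Suc: "sum (wt z) (trees (Suc k)) = z + (sum (wt z) (trees k))\<^sup>2"
proof -
  have "inj_on (case_prod Node) (trees k \<times> trees k)" by (auto intro: inj_onI)
  then have "sum (wt z) (case_prod Node ` (trees k \<times> trees k))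
      = (\<Sum>(l, r)\<in>trees k \<times> trees k. wt z l * wt z r)"
    by (subst sum.reindex) (auto simp: case_prod_unfold)
  also have "\<dots> = (sum (wt z) (trees k))\<^sup>2"
    by (simp add: sum.cartesian_product[symmetric] sum_product power2_eq_square)
  finally show ?thesis by (subst trees.simps, subst sum.insert) auto
qed

text \<open>The length stays strictly below \<open>N\<close>: if \<open>A\<close> has total weight
  \<open>1\<close>, each of the \<open>N\<close> possible lengths contributes \<open>1\<close>, so
  the rows have total weight \<open>N\<close>.\<close>

fun rows :: "tree set \<Rightarrow> nat \<Rightarrow> tree list set" where
  "rows A 0 = {}"
| "rows A (Suc N) = insert [] (case_prod Cons ` (A \<times> rows A N))"

lemma finite_rows [simp]: "finite A \<Longrightarrow> finite (rows A N)"
  by (induction N) auto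

lemma in_rows_iff: "L \<in> rows A N \<longleftrightarrow> set L \<subseteq> A \<and> length L < N"
proof (induction N arbitrary: L)
  case (Suc N)
  then show ?case by (cases L) auto
qed simp

lemma sum_rows_Suc:
  assumes "finite A"
  shows "sum h (rows A (Suc N)) = h [] + (\<Sum>t\<in>A. \<Sum>L\<in>rows A N. h (t # L))"
proof -
  have "inj_on (case_prod Cons) (A \<times> rows A N)" by (auto intro: inj_onI)
  then have "sum h (case_prod Cons ` (A \<times> rows A N)) = (\<Sum>(t, L)\<in>A \<times> rows A N. h (t # L))"
    by (subst sum.reindex) (auto simp: case_prod_unfold)
  then show ?thesis
    using assms by (subst rows.simps, subst sum.insert) (auto simp: sum.cartesian_product)
qed

fun starts_in :: "tree set list \<Rightarrow> tree list \<Rightarrow> bool" where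
  "starts_in [] L = True"
| "starts_in (B # Bs) [] = False"
| "starts_in (B # Bs) (t # L) = (t \<in> B \<and> starts_in Bs L)"

text \<open>Both lists of conditions run outward from the pointer, nearest tree first.\<close>

fun cylinder :: "tree set list \<Rightarrow> tree set \<Rightarrow> tree set list \<Rightarrow> forest \<Rightarrow> bool" where
  "cylinder Ls C Rs (L, c, R) = (starts_in Ls L \<and> c \<in> C \<and> starts_in Rs R)"

lemma sum_of_bool_mem:
  fixes w :: "'a \<Rightarrow> real"
  assumes "finite A" "C \<subseteq> A"
  shows "(\<Sum>c\<in>A. w c * of_bool (c \<in> C)) = sum w C"
proof -
  have "(\<Sum>c\<in>A. w c * of_bool (c \<in> C)) = (\<Sum>c\<in>C. w c * of_bool (c \<in> C))"
    using assms by (intro sum.mono_neutral_right) auto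
  then show ?thesis by simp
qed

declare trees.simps(2) [simp del] rows.simps(2) [simp del]
declare sum_mult_of_bool_eq [simp del] sum_of_bool_mult_eq [simp del]

section \<open>The box of forests as a product of weighted factors\<close>

locale weighted_forests =
  fixes k N :: nat and z :: real
  assumes z: "z \<ge> 0" and total: "sum (wt z) (trees (Suc k)) = 1" and N: "N \<ge> 3"
begin

abbreviation A where "A \<equiv> trees (Suc k)"
abbreviation B where "B \<equiv> trees k"

definition full :: "tree set" where "full = A - B"
definition q :: real where "q = sum (wt z) full"
definition box :: "forest set" where "box = rows A N \<times> (A \<times> rows A N)"

lemma in_box_iff:
  "(L, c, R) \<in> box \<longleftrightarrow> set L \<subseteq> A \<and> length L < N \<and> c \<in> A \<and> set R \<subseteq> A \<and> length R < N"
  by (auto simp: box_def in_rows_iff)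

lemma finite_box [simp]: "finite box"
  by (simp add: box_def)

lemma full_subset: "full \<subseteq> A" by (auto simp: full_def)

lemma in_A_iff: "t \<in> A \<longleftrightarrow> t \<in> B \<or> t \<in> full"
  using trees_mono[of k] by (auto simp: full_def)

lemma Leaf_notin_full [simp]: "Leaf \<notin> full"
  by (simp add: full_def)

lemma full_notin_B [simp]: "t \<in> full \<Longrightarrow> t \<notin> B"
  by (simp add: full_def)

lemma Node_in_A [simp]: "Node l r \<in> A \<longleftrightarrow> l \<in> B \<and> r \<in> B"
  by (auto simp: trees.simps(2))

lemma wt_nonneg [simp]: "wt z t \<ge> 0"
  using z by (induction t) auto

lemma wts_nonneg [simp]: "wts z L \<ge> 0"
  by (induction L) auto

lemma weight_nonneg [simp]: "weight z y \<ge> 0"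
  by (cases y) simp

lemma q_nonneg: "q \<ge> 0"
  unfolding q_def by (intro sum_nonneg) simp

text \<open>Trees of height at most \<open>k\<close> weigh \<open>1 - q\<close>, and the recursion
  for the weights reads \<open>1 = z + (1 - q)^2\<close>. Thus at least one of two independent trees
  is full with probability \<open>z\<close>, the same as for a leaf.\<close>

lemma q_eq: "(1 - q)\<^sup>2 = 1 - z" and q_le_1: "q \<le> 1"
proof -
  have "sum (wt z) A = sum (wt z) full + sum (wt z) B"
    unfolding full_def by (intro sum.subset_diff trees_mono finite_trees)
  then have "sum (wt z) B = 1 - q" using total by (simp add: q_def)
  moreover have "sum (wt z) B \<ge> 0" by (intro sum_nonneg) simp
  ultimately show "(1 - q)\<^sup>2 = 1 - z" "q \<le> 1"
    using total sum_trees_Suc[of z k] by simp_all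
qed

text \<open>Each length from \<open>length Bs\<close> up to \<open>n - 1\<close> contributes the
  product, since the unconstrained trees have total weight \<open>1\<close>. The truncated
  subtraction counts these lengths.\<close>

lemma sum_rows_starts_in:
  assumes "\<forall>C\<in>set Bs. C \<subseteq> A"
  shows "(\<Sum>L\<in>rows A n. wts z L * of_bool (starts_in Bs L))
    = real (n - length Bs) * (\<Prod>C\<leftarrow>Bs. sum (wt z) C)"
  using assms
proof (induction n arbitrary: Bs)
  case (Suc n)
  show ?case
  proof (cases Bs)
    case Nil
    have "(\<Sum>L\<in>rows A n. wts z L) = real n" using Suc.IH[of "[]"] by simp
    then show ?thesis
      using total
      by (simp add: Nil sum_rows_Suc sum_distrib_left[symmetric] sum_distrib_right[symmetric]
         )
  next
    case (Cons C Cs)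
    let ?s = "\<Sum>L\<in>rows A n. wts z L * of_bool (starts_in Cs L)"
    have "(\<Sum>L\<in>rows A (Suc n). wts z L * of_bool (starts_in Bs L))
        = (\<Sum>t\<in>A. \<Sum>L\<in>rows A n. (wt z t * of_bool (t \<in> C)) * (wts z L * of_bool (starts_in Cs L)))"
      by (simp add: Cons sum_rows_Suc of_bool_conj mult_ac)
    also have "\<dots> = sum (wt z) C * ?s"
      using Suc.prems Cons
      by (subst sum_of_bool_mem[symmetric, of A]) (simp_all add: sum_product)
    finally show ?thesis using Suc.IH[of Cs] Suc.prems Cons by simp
  qed
qed simp

lemma sum_rows: "sum (wts z) (rows A n) = real n"
  using sum_rows_starts_in[of "[]" n] by simp

lemma sum_rows_Nil: "(\<Sum>L\<in>rows A n. wts z L * of_bool (L = [])) \<le> 1"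
  by (cases n) (simp_all add: sum_rows_Suc)

text \<open>Rows of one fixed length weigh \<open>1\<close>. The longest rows are those where a move
  would overrun the box.\<close>

lemma sum_rows_longest: "(\<Sum>L\<in>rows A n. wts z L * of_bool (Suc (length L) = n)) \<le> 1"
proof (induction n)
  case (Suc n)
  let ?s = "\<Sum>L\<in>rows A n. wts z L * of_bool (Suc (length L) = n)"
  have "(\<Sum>L\<in>rows A (Suc n). wts z L * of_bool (Suc (length L) = Suc n))
      = of_bool (n = 0) + sum (wt z) A * ?s"
    by (simp add: sum_rows_Suc sum_product mult_ac)
  also have "\<dots> = of_bool (n = 0) + ?s" using total by simp
  also have "\<dots> \<le> 1" using Suc.IH by (cases n) simp_all
  finally show ?case .
qed simp

text \<open>Left row, pointed tree and right row are independent.\<close>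

lemma sum_box_product:
  "(\<Sum>y\<in>box. weight z y * of_bool (P (fst y) \<and> Q (fst (snd y)) \<and> S (snd (snd y))))
    = (\<Sum>L\<in>rows A N. wts z L * of_bool (P L)) * ((\<Sum>c\<in>A. wt z c * of_bool (Q c))
      * (\<Sum>R\<in>rows A N. wts z R * of_bool (S R)))"
proof -
  have "(\<Sum>y\<in>box. weight z y * of_bool (P (fst y) \<and> Q (fst (snd y)) \<and> S (snd (snd y))))
    = (\<Sum>(L, x)\<in>rows A N \<times> (A \<times> rows A N). wts z L * of_bool (P L) *
        (case x of (c, R) \<Rightarrow> wt z c * of_bool (Q c) * (wts z R * of_bool (S R))))"
    unfolding box_def by (intro sum.cong) auto
  also have "\<dots> = (\<Sum>L\<in>rows A N. wts z L * of_bool (P L)) *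
      (\<Sum>(c, R)\<in>A \<times> rows A N. wt z c * of_bool (Q c) * (wts z R * of_bool (S R)))"
    by (subst sum.cartesian_product[symmetric], subst sum_product, rule HOL.refl)
  also have "(\<Sum>(c, R)\<in>A \<times> rows A N. wt z c * of_bool (Q c) * (wts z R * of_bool (S R)))
      = (\<Sum>c\<in>A. wt z c * of_bool (Q c)) * (\<Sum>R\<in>rows A N. wts z R * of_bool (S R))"
    by (subst sum.cartesian_product[symmetric], subst sum_product, rule HOL.refl)
  finally show ?thesis .
qed

section \<open>Masses of patterns and the lowered weight\<close>

definition mass :: "(forest \<Rightarrow> bool) \<Rightarrow> real" where
  "mass P = (\<Sum>y\<in>box. weight z y * of_bool (P y))"

lemma mass_cylinder:
  assumes "\<forall>C\<in>set Ls. C \<subseteq> A" "C \<subseteq> A" "\<forall>C\<in>set Rs. C \<subseteq> A"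
  shows "mass (cylinder Ls C Rs) = (real (N - length Ls) * (\<Prod>C\<leftarrow>Ls. sum (wt z) C)) *
    (sum (wt z) C * (real (N - length Rs) * (\<Prod>C\<leftarrow>Rs. sum (wt z) C)))"
proof -
  have "cylinder Ls C Rs y \<longleftrightarrow>
      starts_in Ls (fst y) \<and> fst (snd y) \<in> C \<and> starts_in Rs (snd (snd y))" for y
    by (cases y) simp
  then show ?thesis
    using assms
    using sum_box_product[of "starts_in Ls" "\<lambda>c. c \<in> C" "starts_in Rs"]
    by (simp add: mass_def sum_rows_starts_in sum_of_bool_mem)
qed

lemma mass_left_le:
  assumes "(\<Sum>L\<in>rows A N. wts z L * of_bool (P L)) \<le> 1"
  shows "mass (\<lambda>y. P (fst y)) \<le> N"
proof -
  have "mass (\<lambda>y. P (fst y)) = (\<Sum>L\<in>rows A N. wts z L * of_bool (P L)) * N"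
    using sum_box_product[of P "\<lambda>_. True" "\<lambda>_. True"] total sum_rows[of N]
    by (simp add: mass_def)
  then show ?thesis using mult_right_mono[OF assms, of "real N"] by simp
qed

lemma mass_right_le:
  assumes "(\<Sum>L\<in>rows A N. wts z L * of_bool (P L)) \<le> 1"
  shows "mass (\<lambda>y. P (snd (snd y))) \<le> N"
proof -
  have "mass (\<lambda>y. P (snd (snd y))) = (\<Sum>L\<in>rows A N. wts z L * of_bool (P L)) * N"
    using sum_box_product[of "\<lambda>_. True" "\<lambda>_. True" P] total sum_rows[of N]
    by (simp add: mass_def mult.commute)
  then show ?thesis using mult_right_mono[OF assms, of "real N"] by simp
qed

text \<open>The run leaf, full, leaf, full with the pointer on its first, second and third tree. In
  \<open>p3\<close> the left row is read backwards, hence \<open>full\<close> before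
  \<open>Leaf\<close>.\<close>

definition p1 where "p1 = cylinder [] {Leaf} [full, {Leaf}, full]"
definition p2 where "p2 = cylinder [{Leaf}] full [{Leaf}, full]"
definition p3 where "p3 = cylinder [full, {Leaf}] {Leaf} [full]"

lemmas pattern_defs = p1_def p2_def p3_def

lemma mass_patterns:
  "mass p1 = (real N * (real N - 3)) * (z\<^sup>2 * q\<^sup>2)"
  "mass p2 = ((real N - 1) * (real N - 2)) * (z\<^sup>2 * q\<^sup>2)"
  "mass p3 = ((real N - 1) * (real N - 2)) * (z\<^sup>2 * q\<^sup>2)"
  using N full_subset unfolding pattern_defs
  by (simp_all add: mass_cylinder q_def[symmetric] of_nat_diff power2_eq_square)

definition restr :: "(forest \<Rightarrow> real) \<Rightarrow> forest \<Rightarrow> real" where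
  "restr u y = (if y \<in> box then weight z y * u y else 0)"

text \<open>Runs may overlap: \<open>p1\<close> and \<open>p3\<close> can hold together, but neither
  together with \<open>p2\<close>. Lowering by one half per pattern therefore keeps \<open>f\<close>
  nonnegative.\<close>

definition f :: "forest \<Rightarrow> real" where
  "f = restr (\<lambda>y. 1 - (of_bool (p1 y) + of_bool (p2 y) + of_bool (p3 y)) / 2)"

definition pm :: "(forest \<Rightarrow> bool) \<Rightarrow> forest \<Rightarrow> real" where
  "pm P = restr (\<lambda>y. of_bool (P y))"

lemma f_nonneg: "f y \<ge> 0"
  by (cases y) (auto simp: f_def restr_def pattern_defs of_bool_def)

lemma sum_pm: "sum (pm P) box = mass P"
  unfolding mass_def pm_def restr_def by (intro sum.cong) auto

lemma sum_f: "sum f box = (real N)\<^sup>2 - (mass p1 + mass p2 + mass p3) / 2"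
proof -
  have "sum f box = (\<Sum>y\<in>box. weight z y * of_bool True - (weight z y * of_bool (p1 y)
      + weight z y * of_bool (p2 y) + weight z y * of_bool (p3 y)) / 2)"
    unfolding f_def restr_def by (intro sum.cong) (auto simp: field_simps)
  also have "\<dots> = mass (\<lambda>_. True) - (mass p1 + mass p2 + mass p3) / 2"
    unfolding mass_def by (simp only: sum_subtractf sum.distrib sum_divide_distrib[symmetric])
  also have "mass (\<lambda>_. True) = (real N)\<^sup>2"
    using sum_box_product[of "\<lambda>_. True" "\<lambda>_. True" "\<lambda>_. True"] total sum_rows[of N]
    by (simp add: mass_def power2_eq_square)
  finally show ?thesis .
qed

section \<open>Total variation of \<open>f\<close> along the four moves\<close>

lemma sum_pm_move:
  assumes "m \<in> {move_right, move_left, join, split}"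
  shows "(\<Sum>y\<in>box. case_option 0 (pm P) (m y)) \<le> mass P"
  unfolding sum_pm[symmetric]
proof (rule sum_partial_inj_le[where Y = box])
  show "x = x'" if "m x = Some y" "m x' = Some y" for x x' y
    using moves_inj[OF assms that] .
qed (auto simp: pm_def restr_def)

text \<open>The move carries \<open>p1\<close> to \<open>p2\<close> and \<open>p2\<close> to
  \<open>p3\<close>, so inside the box \<open>f\<close> can drop only on entering a run at
  \<open>p1\<close>. The term \<open>2 * real N\<close> pays for an empty right row and for a left
  row of maximal length.\<close>

lemma tv_move_right: "total_variation box move_right f \<le> 2 * real N + mass p1 / 2"
proof -
  let ?b = "\<lambda>y. weight z y * of_bool (snd (snd y) = []) + weight z y * of_bool (Suc (length (fst y)) = N)
    + case_option 0 (pm p1) (move_right y) / 2"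
  have "max 0 (f y - case_option 0 f (move_right y)) \<le> ?b y" if "y \<in> box" for y
  proof -
    obtain L c R where y: "y = (L, c, R)" by (cases y)
    define W where "W = weight z y"
    have W: "weight z y = W" "W \<ge> 0" by (simp_all add: W_def)
    have fy: "f y = W * (1 - (of_bool (p1 y) + of_bool (p2 y) + of_bool (p3 y)) / 2)"
      using that W by (simp add: f_def restr_def)
    show ?thesis
    proof (cases R)
      case Nil
      then have "\<not> p1 y" "\<not> p2 y" "\<not> p3 y" by (simp_all add: y pattern_defs)
      then show ?thesis using W fy by (simp add: y Nil del: weight.simps)
    next
      case (Cons d R')
      let ?y = "(c # L, d, R')"
      have m: "move_right y = Some ?y" by (simp add: y Cons)
      then have w: "weight z ?y = W" using weight_move[where m = move_right, OF _ m] W by simp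
      have p: "p2 ?y \<longleftrightarrow> p1 y" "p3 ?y \<longleftrightarrow> p2 y" by (auto simp: y Cons pattern_defs)
      show ?thesis
      proof (cases "Suc (length L) = N")
        case True
        then have "?y \<notin> box" by (simp add: in_box_iff)
        then have "f ?y = 0" "pm p1 ?y = 0" by (simp_all add: f_def pm_def restr_def)
        then show ?thesis using W fy True f_nonneg[of y] unfolding m
          by (simp add: y Cons of_bool_def del: weight.simps)
      next
        case False
        then have b: "?y \<in> box" using that by (simp add: y Cons in_box_iff)
        have "f ?y = W * (1 - (of_bool (p1 ?y) + of_bool (p1 y) + of_bool (p2 y)) / 2)"
          "pm p1 ?y = W * of_bool (p1 ?y)"
          using b w p by (simp_all add: f_def pm_def restr_def)
        then show ?thesis using W fy False unfolding m
          by (simp add: y Cons of_bool_def del: weight.simps)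
      qed
    qed
  qed
  then have "total_variation box move_right f \<le> sum ?b box"
    unfolding total_variation_def by (rule sum_mono)
  also have "\<dots> \<le> 2 * real N + mass p1 / 2"
    using mass_right_le[OF sum_rows_Nil] mass_left_le[OF sum_rows_longest]
      sum_pm_move[of move_right p1]
    by (simp add: sum.distrib sum_divide_distrib[symmetric] mass_def)
  finally show ?thesis .
qed

text \<open>The mirror image: runs are now entered at \<open>p3\<close>.\<close>

lemma tv_move_left: "total_variation box move_left f \<le> 2 * real N + mass p3 / 2"
proof -
  let ?b = "\<lambda>y. weight z y * of_bool (fst y = []) + weight z y * of_bool (Suc (length (snd (snd y))) = N)
    + case_option 0 (pm p3) (move_left y) / 2"
  have "max 0 (f y - case_option 0 f (move_left y)) \<le> ?b y" if "y \<in> box" for y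
  proof -
    obtain L c R where y: "y = (L, c, R)" by (cases y)
    define W where "W = weight z y"
    have W: "weight z y = W" "W \<ge> 0" by (simp_all add: W_def)
    have fy: "f y = W * (1 - (of_bool (p1 y) + of_bool (p2 y) + of_bool (p3 y)) / 2)"
      using that W by (simp add: f_def restr_def)
    show ?thesis
    proof (cases L)
      case Nil
      then show ?thesis using W fy by (simp add: y of_bool_def del: weight.simps)
    next
      case (Cons d L')
      let ?y = "(L', d, c # R)"
      have m: "move_left y = Some ?y" by (simp add: y Cons)
      then have w: "weight z ?y = W" using weight_move[where m = move_left, OF _ m] W by simp
      have p: "p1 ?y \<longleftrightarrow> p2 y" "p2 ?y \<longleftrightarrow> p3 y" by (auto simp: y Cons pattern_defs)
      show ?thesis
      proof (cases "Suc (length R) = N")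
        case True
        then have "?y \<notin> box" by (simp add: in_box_iff)
        then have "f ?y = 0" "pm p3 ?y = 0" by (simp_all add: f_def pm_def restr_def)
        then show ?thesis using W fy True f_nonneg[of y] unfolding m
          by (simp add: y Cons of_bool_def del: weight.simps)
      next
        case False
        then have b: "?y \<in> box" using that by (simp add: y Cons in_box_iff)
        have "f ?y = W * (1 - (of_bool (p2 y) + of_bool (p3 y) + of_bool (p3 ?y)) / 2)"
          "pm p3 ?y = W * of_bool (p3 ?y)"
          using b w p by (simp_all add: f_def pm_def restr_def)
        then show ?thesis using W fy False unfolding m
          by (simp add: y Cons of_bool_def del: weight.simps)
      qed
    qed
  qed
  then have "total_variation box move_left f \<le> sum ?b box"
    unfolding total_variation_def by (rule sum_mono)
  also have "\<dots> \<le> 2 * real N + mass p3 / 2"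
    using mass_left_le[OF sum_rows_Nil] mass_right_le[OF sum_rows_longest]
      sum_pm_move[of move_left p3]
    by (simp add: sum.distrib sum_divide_distrib[symmetric] mass_def)
  finally show ?thesis .
qed

text \<open>A full tree at the pointer or just after it would make the joined tree too high for the
  box.\<close>

definition blocked :: "forest \<Rightarrow> bool" where
  "blocked y \<longleftrightarrow> cylinder [] full [] y \<or> cylinder [] A [full] y"

text \<open>By inclusion and exclusion the density is \<open>1 - (1 - q)^2\<close>, which is
  \<open>z\<close>; the correction of order \<open>N\<close> for empty right rows has the favourable
  sign.\<close>

lemma mass_blocked: "mass blocked \<le> (real N)\<^sup>2 * z"
proof -
  have "of_bool (blocked y) = (of_bool (cylinder [] full [] y) + of_bool (cylinder [] A [full] y)
      - of_bool (cylinder [] full [full] y) :: real)" for y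
    using full_subset by (cases y) (auto simp: blocked_def)
  then have "mass blocked = mass (cylinder [] full []) + mass (cylinder [] A [full])
      - mass (cylinder [] full [full])"
    unfolding mass_def
    by (simp only: distrib_left right_diff_distrib sum.distrib sum_subtractf)
  also have "\<dots> = N * (q * N) + N * ((real N - 1) * q) - N * (q * ((real N - 1) * q))"
    using N full_subset total
    by (simp add: mass_cylinder q_def[symmetric] of_nat_diff)
  also have "\<dots> = (real N)\<^sup>2 * (1 - (1 - q)\<^sup>2) - N * (q * (1 - q))"
    by (simp add: power2_eq_square algebra_simps)
  also have "\<dots> \<le> (real N)\<^sup>2 * z"
    using q_nonneg q_le_1 by (simp add: q_eq)
  finally show ?thesis .
qed

text \<open>All three patterns are blocked, and a blocked forest loses all of its value, so lowering
  the weight there saves half of each mass. An unblocked join yields a pointed \<open>Node\<close>,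
  which can only fit \<open>p2\<close>; this costs \<open>mass p2 / 2\<close>.\<close>

lemma tv_join: "total_variation box join f
    \<le> N + (real N)\<^sup>2 * z - (mass p1 + mass p2 + mass p3) / 2 + mass p2 / 2"
proof -
  let ?b = "\<lambda>y. weight z y * of_bool (snd (snd y) = []) + weight z y * of_bool (blocked y)
    - (weight z y * of_bool (p1 y) + weight z y * of_bool (p2 y) + weight z y * of_bool (p3 y)) / 2
    + case_option 0 (pm p2) (join y) / 2"
  have "max 0 (f y - case_option 0 f (join y)) \<le> ?b y" if "y \<in> box" for y
  proof -
    obtain L c R where y: "y = (L, c, R)" by (cases y)
    define W where "W = weight z y"
    have W: "weight z y = W" "W \<ge> 0" by (simp_all add: W_def)
    have fy: "f y = W * (1 - (of_bool (p1 y) + of_bool (p2 y) + of_bool (p3 y)) / 2)"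
      using that W by (simp add: f_def restr_def)
    show ?thesis
    proof (cases R)
      case Nil
      then have "\<not> p1 y" "\<not> p2 y" "\<not> p3 y" by (simp_all add: y pattern_defs)
      then show ?thesis using W fy by (simp add: y Nil del: weight.simps)
    next
      case (Cons d R')
      let ?y = "(L, Node c d, R')"
      have m: "join y = Some ?y" by (simp add: y Cons)
      then have w: "weight z ?y = W" using weight_move[where m = join, OF _ m] W by simp
      have cd: "c \<in> A" "d \<in> A" using that by (simp_all add: y Cons in_box_iff)
      show ?thesis
      proof (cases "blocked y")
        case True
        then have "c \<in> full \<or> d \<in> full" by (auto simp: blocked_def y Cons)
        then have "?y \<notin> box" by (auto simp: in_box_iff)
        then have "f ?y = 0" "pm p2 ?y = 0" by (simp_all add: f_def pm_def restr_def)
        then show ?thesis using W fy True f_nonneg[of y] unfolding m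
          by (simp add: y Cons algebra_simps add_divide_distrib del: weight.simps)
      next
        case False
        then have nf: "c \<notin> full" "d \<notin> full" using cd by (auto simp: blocked_def y Cons)
        then have "c \<in> B" "d \<in> B" using cd by (simp_all add: in_A_iff)
        then have "?y \<in> box" using that by (simp add: y Cons in_box_iff)
        moreover have "\<not> p1 ?y" "\<not> p3 ?y" by (simp_all add: pattern_defs)
        ultimately have "f ?y = W * (1 - of_bool (p2 ?y) / 2)"
          "pm p2 ?y = W * of_bool (p2 ?y)"
          using w by (simp_all add: f_def pm_def restr_def)
        moreover have "\<not> p1 y" "\<not> p2 y" "\<not> p3 y" using nf by (simp_all add: y Cons pattern_defs)
        ultimately show ?thesis using W fy False unfolding m
          by (simp add: y Cons of_bool_def del: weight.simps)
      qed
    qed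
  qed
  then have "total_variation box join f \<le> sum ?b box"
    unfolding total_variation_def by (rule sum_mono)
  also have "\<dots> \<le> N + (real N)\<^sup>2 * z - (mass p1 + mass p2 + mass p3) / 2 + mass p2 / 2"
    using mass_right_le[OF sum_rows_Nil] mass_blocked sum_pm_move[of join p2]
    by (simp add: sum.distrib sum_subtractf sum_divide_distrib[symmetric] mass_def)
  finally show ?thesis .
qed

text \<open>At a leaf the whole value is lost, which is lowered on \<open>p1\<close> and
  \<open>p3\<close>. Splitting a \<open>Node\<close> leaves trees of \<open>B\<close> at the pointer
  and after it, while every pattern has a full tree in one of these places; so \<open>f\<close> does
  not drop unless the right row becomes too long.\<close>

lemma tv_split: "total_variation box split f \<le> N + (real N)\<^sup>2 * z - (mass p1 + mass p3) / 2"
proof -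
  let ?b = "\<lambda>y. weight z y * of_bool (Suc (length (snd (snd y))) = N)
    + weight z y * of_bool (cylinder [] {Leaf} [] y)
    - (weight z y * of_bool (p1 y) + weight z y * of_bool (p3 y)) / 2"
  have "max 0 (f y - case_option 0 f (split y)) \<le> ?b y" if "y \<in> box" for y
  proof -
    obtain L t R where y: "y = (L, t, R)" by (cases y)
    define W where "W = weight z y"
    have W: "weight z y = W" "W \<ge> 0" by (simp_all add: W_def)
    have fy: "f y = W * (1 - (of_bool (p1 y) + of_bool (p2 y) + of_bool (p3 y)) / 2)"
      using that W by (simp add: f_def restr_def)
    show ?thesis
    proof (cases t)
      case Leaf
      then have "\<not> p2 y" by (simp add: y p2_def)
      then show ?thesis using W fy by (simp add: y Leaf of_bool_def del: weight.simps)
    next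
      case (Node c d)
      let ?y = "(L, c, d # R)"
      have m: "split y = Some ?y" by (simp add: y Node)
      then have w: "weight z ?y = W" using weight_move[where m = split, OF _ m] W by simp
      have cd: "c \<in> B" "d \<in> B" using that by (simp_all add: y Node in_box_iff)
      have p: "\<not> p1 y" "\<not> p3 y" by (simp_all add: y Node pattern_defs)
      show ?thesis
      proof (cases "Suc (length R) = N")
        case True
        then have "?y \<notin> box" by (simp add: in_box_iff)
        then have "f ?y = 0" by (simp add: f_def restr_def)
        then show ?thesis using W fy True p unfolding m
          by (simp add: y Node of_bool_def del: weight.simps)
      next
        case False
        then have "?y \<in> box"
          using that cd by (auto simp: y Node in_box_iff in_A_iff)
        moreover have "\<not> p1 ?y" "\<not> p2 ?y" "\<not> p3 ?y" using cd full_notin_B by (auto simp: pattern_defs)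
        ultimately have "f ?y = W"
          using w by (simp add: f_def restr_def)
        then show ?thesis using W fy False p unfolding m
          by (simp add: y Node of_bool_def del: weight.simps)
      qed
    qed
  qed
  then have "total_variation box split f \<le> sum ?b box"
    unfolding total_variation_def by (rule sum_mono)
  also have "\<dots> = mass (\<lambda>y. Suc (length (snd (snd y))) = N) + mass (cylinder [] {Leaf} [])
      - (mass p1 + mass p3) / 2"
    by (simp add: sum.distrib sum_subtractf sum_divide_distrib[symmetric] mass_def)
  also have "mass (cylinder [] {Leaf} []) = (real N)\<^sup>2 * z"
    by (simp add: mass_cylinder power2_eq_square)
  also have "mass (\<lambda>y. Suc (length (snd (snd y))) = N) \<le> N"
    by (rule mass_right_le[OF sum_rows_longest])
  finally show ?thesis by simp
qed

lemma thompson_set: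
  assumes "6 * real N + (2 * z - 1 / 2) * (real N)\<^sup>2 < (real N * (real N - 3)) * (z\<^sup>2 * q\<^sup>2) / 4"
  shows "\<exists>S\<in>finite_subgraphs thompson_F.
    card (cheeger_boundary thompson_F {thompson_x 0, thompson_x 1} S) < 1 / 2 * real (card S)"
proof (rule thompson_set_from_forests[of box f])
  \<comment> \<open>The four bounds add up to
    \<open>6 * N + 2 * z * N^2 - (mass p1 + mass p3) / 2\<close>, while half of
    \<open>sum f box\<close> is \<open>N^2 / 2 - (mass p1 + mass p2 + mass p3) / 4\<close>. As
    \<open>p2\<close> and \<open>p3\<close> have equal mass, the net gain is
    \<open>mass p1 / 4\<close>.\<close>
  have "mass p2 = mass p3" by (simp add: mass_patterns)
  moreover have "6 * real N + 2 * ((real N)\<^sup>2 * z) - (real N)\<^sup>2 / 2 < mass p1 / 4"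
    using assms by (simp add: mass_patterns algebra_simps)
  ultimately show "total_variation box move_right f + total_variation box move_left f
      + total_variation box join f + total_variation box split f < 1 / 2 * sum f box"
    using tv_move_right tv_move_left tv_join tv_split
    unfolding sum_f add_divide_distrib right_diff_distrib distrib_left by linarith
qed (rule finite_box f_nonneg | simp add: f_def restr_def)+

end

section \<open>Choice of the parameters\<close>

lemma continuous_wt: "continuous_on S (\<lambda>z. wt z t)"
  by (induction t) (auto intro: continuous_intros)

text \<open>For \<open>z = 1/4\<close> the recursion has the fixed point \<open>1/2\<close>, and the
  sums start below it.\<close>

lemma sum_trees_quarter: "0 \<le> sum (wt (1 / 4)) (trees k) \<and> sum (wt (1 / 4)) (trees k) \<le> 1 / 2"
proof (induction k)
  case (Suc k)
  then have "(sum (wt (1 / 4)) (trees k))\<^sup>2 \<le> (1 / 2)\<^sup>2" by (intro power_mono) auto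
  then show ?case unfolding sum_trees_Suc by (simp add: power_divide)
qed simp

text \<open>Since \<open>x\<^sup>2 + 1/4 \<ge> x\<close>, each level adds at least \<open>e\<close>.\<close>

lemma sum_trees_ge: "real k * e \<le> sum (wt (1 / 4 + e)) (trees k)" if "e \<ge> 0"
proof (induction k)
  case (Suc k)
  have "(sum (wt (1 / 4 + e)) (trees k) - 1 / 2)\<^sup>2 \<ge> 0" by simp
  then show ?case using Suc unfolding sum_trees_Suc by (simp add: power2_eq_square algebra_simps)
qed (use that in simp)

text \<open>At \<open>1/4\<close> the total weight is below \<open>1\<close> for every
  \<open>k\<close>, at \<open>1/4 + e\<close> it exceeds \<open>1\<close> for large
  \<open>k\<close>; the intermediate value theorem gives \<open>z\<close>.\<close>

lemma exists_weight:
  assumes "e > 0"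
  obtains k z where "1 / 4 \<le> z" "z \<le> 1 / 4 + e" "sum (wt z) (trees (Suc k)) = 1"
proof -
  obtain k where "1 < real k * e" using reals_Archimedean3[OF assms] by blast
  moreover have "real k * e \<le> real (Suc k) * e" using assms by (simp add: algebra_simps)
  ultimately have "1 \<le> sum (wt (1 / 4 + e)) (trees (Suc k))"
    using sum_trees_ge[of e "Suc k"] assms by linarith
  moreover have "sum (wt (1 / 4)) (trees (Suc k)) \<le> 1"
    using sum_trees_quarter[of "Suc k"] by linarith
  moreover have cont: "continuous_on {1 / 4..1 / 4 + e} (\<lambda>z. sum (wt z) (trees (Suc k)))"
    by (intro continuous_on_sum continuous_wt)
  ultimately obtain z where "1 / 4 \<le> z" "z \<le> 1 / 4 + e" "sum (wt z) (trees (Suc k)) = 1"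
    using IVT'[of "\<lambda>z. sum (wt z) (trees (Suc k))" "1 / 4" 1 "1 / 4 + e"] assms cont by auto
  then show ?thesis by (rule that)
qed

theorem theorem1:
  shows "cayley_density thompson_F {thompson_x 0, thompson_x 1} > 7 / 2 \<and>
         cheeger_constant thompson_F {thompson_x 0, thompson_x 1} < 1 / 2"
proof -
  \<comment> \<open>After division by \<open>N^2\<close>, the losses are at most
    \<open>1/20000\<close> from \<open>z\<close> and \<open>6/1000000\<close> from the edges of the
    box; the gain is at least \<open>1/4096\<close> up to the factor \<open>1 - 3/N\<close>.\<close>
  obtain k z where kz: "1 / 4 \<le> z" "z \<le> 1 / 4 + 1 / 40000" "sum (wt z) (trees (Suc k)) = 1"
    by (rule exists_weight[of "1 / 40000"]) auto
  define N :: nat where "N = 1000000"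
  interpret weighted_forests k N z
    by unfold_locales (use kz in \<open>auto simp: N_def\<close>)
  \<comment> \<open>Since \<open>z\<close> is at least \<open>1/4\<close>, \<open>(1 - q)^2\<close>
    is at most \<open>3/4\<close>, which is below \<open>(7/8)^2\<close>.\<close>
  have "1 / 8 \<le> q"
  proof (rule ccontr)
    assume "\<not> 1 / 8 \<le> q"
    then have "(7 / 8)\<^sup>2 \<le> (1 - q)\<^sup>2" by (intro power_mono) auto
    then show False using q_eq kz by (simp add: power_divide)
  qed
  then have "(1 / 8)\<^sup>2 \<le> q\<^sup>2" "(1 / 4)\<^sup>2 \<le> z\<^sup>2" using kz by (auto intro: power_mono)
  then have "(1 / 4)\<^sup>2 * (1 / 8)\<^sup>2 \<le> z\<^sup>2 * q\<^sup>2" by (intro mult_mono) auto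
  then have "1 / 1024 \<le> z\<^sup>2 * q\<^sup>2" by (simp add: power_divide)
  then have "(real N * (real N - 3)) * (1 / 1024) \<le> (real N * (real N - 3)) * (z\<^sup>2 * q\<^sup>2)"
    by (intro mult_left_mono) (auto simp: N_def)
  moreover have "(2 * z - 1 / 2) * (real N)\<^sup>2 \<le> (1 / 20000) * (real N)\<^sup>2"
    using kz by (intro mult_right_mono) auto
  ultimately have "6 * real N + (2 * z - 1 / 2) * (real N)\<^sup>2
      < (real N * (real N - 3)) * (z\<^sup>2 * q\<^sup>2) / 4"
    by (simp add: N_def)
  from thompson_set[OF this] show ?thesis
    using thompson_density_cheeger[of _ "1 / 2"] by fastforce
qed

end
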